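(* Let $\mathbb{A}$ be a unital $C^*$-algebra, let $(X,\mathbb{A},d)$ be a $C^*$-algebra-valued $b$-metric space with coefficient $A\succeq 1_{\mathbb{A}}$, and let $G$ be a directed graph without parallel edges with $V(G)=X$ and $E(G)\supseteq\Delta=\{(x,x):x\in X\}$. Let $f,g:X\to X$ be mappings for which there is $B\in\mathbb{A}$ with $\|A\|\,\|B\|^{2}<1$ such that $$d(fx,fy)\preceq B^{*}\,d(gx,gy)\,B\qquad\text{for all }x,y\in X\text{ with }(gx,gy)\in E(\tilde G).$$ Suppose that $f(X)\subseteq g(X)$, that $g(X)$ is a complete subspace of $X$, and that the following property holds: whenever $(gx_n)$ is a sequence (with $x_n\in X$) such that $gx_n\to x$ for some $x\in X$ and $(gx_n,gx_{n+1})\in E(\tilde G)$ for all $n\ge 1$, there is a subsequence $(gx_{n_i})$ with $(gx_{n_i},x)\in E(\tilde G)$ for all $i\ge 1$. If $C_{gf}\neq\emptyset$, then $PC(f,g)\neq\emptyset$. Moreover, if in addition $(x,y)\in E(\tilde G)$ for all $x,y\in PC(f,g)$, then $PC(f,g)$ is a singleton. Furthermore, if in addition $f$ and $g$ are weakly compatible, then $f$ and $g$ have a unique common fixed point in $X$.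
   Context: For a unital $C^*$-algebra $\mathbb{A}$ with unit $1_{\mathbb{A}}$ and zero $0_{\mathbb{A}}$, $\mathbb{A}_+$ is the set of positive elements, and $a\preceq b$ (equivalently $b\succeq a$) means $b-a\in\mathbb{A}_+$. A $C^*$-algebra-valued $b$-metric space $(X,\mathbb{A},d)$ with coefficient $A$, where $A\in\mathbb{A}_+$ and $A\succeq 1_{\mathbb{A}}$, is a nonempty set $X$ with a map $d:X\times X\to\mathbb{A}_+$ such that for all $x,y,z\in X$: (1) $0_{\mathbb{A}}\preceq d(x,y)$, and $d(x,y)=0_{\mathbb{A}}$ iff $x=y$; (2) $d(x,y)=d(y,x)$; (3) $d(x,y)\preceq A[d(x,z)+d(z,y)]$. A sequence $(x_n)$ converges to $x$ if $\|d(x_n,x)\|\to 0$; it is Cauchy if for every $\epsilon>0$ there is $N$ with $\|d(x_n,x_m)\|\le\epsilon$ for all $n,m\ge N$. A subset of $X$ is a complete subspace if every Cauchy sequence in it converges to a point of it. For a directed graph $G$ without parallel edges, $E(G)\subseteq V(G)\times V(G)$, and $\tilde G$ is the graph with the same vertices and $E(\tilde G)=E(G)\cup\{(x,y):(y,x)\in E(G)\}$. When $f(X)\subseteq g(X)$, starting from any $x_0\in X$ one can construct a sequence $(x_n)_{n\ge0}$ with $gx_n=fx_{n-1}$ for all $n\ge1$. $C_{gf}$ denotes the set of all $x_0\in X$ for which there is such a sequence starting at $x_0$ with $(gx_n,gx_m)\in E(\tilde G)$ for all $m,n=0,1,2,\dots$. $PC(f,g)$ is the set of points of coincidence of $f$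 and $g$: all $y\in X$ such that $y=fx=gx$ for some $x\in X$. A common fixed point is $x\in X$ with $x=fx=gx$. $f$ and $g$ are weakly compatible if $f(gx)=g(fx)$ whenever $fx=gx$. *)

theory Defs
  imports "HOL-Analysis.Analysis" "Graph_Theory.Digraph_Component"
begin

text \<open>
  A unital C*-algebra is a complex Banach algebra with unit, given here as a (real) unital Banach
  algebra with a compatible complex scalar multiplication, together with an involution satisfying
  the C*-identity. As usual for unital Banach algebras, the norm of 1 is 1 (so the zero algebra
  is excluded).
\<close>

class unital_cstar_algebra = real_normed_algebra_1 + banach +
  fixes scaleC :: "complex \<Rightarrow> 'a \<Rightarrow> 'a"
    and adj :: "'a \<Rightarrow> 'a"
  assumes scaleC_add_right: "scaleC c (x + y) = scaleC c x + scaleC c y"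
    and scaleC_add_left: "scaleC (b + c) x = scaleC b x + scaleC c x"
    and scaleC_scaleC: "scaleC b (scaleC c x) = scaleC (b * c) x"
    and scaleC_of_real: "scaleC (complex_of_real r) x = scaleR r x"
    and mult_scaleC_left: "scaleC c x * y = scaleC c (x * y)"
    and mult_scaleC_right: "x * scaleC c y = scaleC c (x * y)"
    and norm_scaleC: "norm (scaleC c x) = cmod c * norm x"
    and adj_adj: "adj (adj x) = x"
    and adj_add: "adj (x + y) = adj x + adj y"
    and adj_scaleC: "adj (scaleC c x) = scaleC (cnj c) (adj x)"
    and adj_mult: "adj (x * y) = adj y * adj x"
    and cstar_identity: "norm (adj x * x) = (norm x)\<^sup>2"

definition spectrum :: "'a::unital_cstar_algebra \<Rightarrow> complex set" where
  "spectrum a = {z. \<not> (\<exists>b. (scaleC z 1 - a) * b = 1 \<and> b * (scaleC z 1 - a) = 1)}"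

definition positive :: "'a::unital_cstar_algebra \<Rightarrow> bool" where
  "positive a \<longleftrightarrow> adj a = a \<and> spectrum a \<subseteq> \<real>\<^sub>\<ge>\<^sub>0"

definition cstar_le :: "'a::unital_cstar_algebra \<Rightarrow> 'a \<Rightarrow> bool" (infix "\<preceq>" 50) where
  "a \<preceq> b \<longleftrightarrow> positive (b - a)"

locale cstar_b_metric_space =
  fixes X :: "'x set"
    and d :: "'x \<Rightarrow> 'x \<Rightarrow> 'a::unital_cstar_algebra"
    and A :: 'a
  assumes nonempty: "X \<noteq> {}"
    and coeff_positive: "positive A"
    and coeff_ge_one: "1 \<preceq> A"
    and dist_nonneg: "\<lbrakk>x \<in> X; y \<in> X\<rbrakk> \<Longrightarrow> 0 \<preceq> d x y"
    and dist_eq_0_iff: "\<lbrakk>x \<in> X; y \<in> X\<rbrakk> \<Longrightarrow> d x y = 0 \<longleftrightarrow> x = y"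
    and dist_sym: "\<lbrakk>x \<in> X; y \<in> X\<rbrakk> \<Longrightarrow> d x y = d y x"
    and dist_triangle: "\<lbrakk>x \<in> X; y \<in> X; z \<in> X\<rbrakk> \<Longrightarrow> d x y \<preceq> A * (d x z + d z y)"

definition cstar_converges ::
    "('x \<Rightarrow> 'x \<Rightarrow> 'a::unital_cstar_algebra) \<Rightarrow> (nat \<Rightarrow> 'x) \<Rightarrow> 'x \<Rightarrow> bool" where
  "cstar_converges d s x \<longleftrightarrow> (\<lambda>n. norm (d (s n) x)) \<longlonglongrightarrow> 0"

definition cstar_Cauchy ::
    "('x \<Rightarrow> 'x \<Rightarrow> 'a::unital_cstar_algebra) \<Rightarrow> (nat \<Rightarrow> 'x) \<Rightarrow> bool" where
  "cstar_Cauchy d s \<longleftrightarrow> (\<forall>e>0. \<exists>N. \<forall>n\<ge>N. \<forall>m\<ge>N. norm (d (s n) (s m)) \<le> e)"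

definition cstar_complete ::
    "('x \<Rightarrow> 'x \<Rightarrow> 'a::unital_cstar_algebra) \<Rightarrow> 'x set \<Rightarrow> bool" where
  "cstar_complete d S \<longleftrightarrow>
     (\<forall>s. (\<forall>n. s n \<in> S) \<and> cstar_Cauchy d s \<longrightarrow> (\<exists>x\<in>S. cstar_converges d s x))"

text \<open>
  A directed graph without parallel edges is a \<open>pair_wf_digraph\<close>; it may be infinite and have loops.
  The arcs of \<open>mk_symmetric G\<close> are those of \<open>G\<close> together with their reversals.
\<close>

abbreviation sym_edges :: "'x pair_pre_digraph \<Rightarrow> ('x \<times> 'x) set" where
  "sym_edges G \<equiv> parcs (mk_symmetric (with_proj G))"

definition C_gf :: "'x pair_pre_digraph \<Rightarrow> ('x \<Rightarrow> 'x) \<Rightarrow> ('x \<Rightarrow> 'x) \<Rightarrow> 'x set" where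
  "C_gf G g f = {x0 \<in> pverts G. \<exists>s :: nat \<Rightarrow> 'x. s 0 = x0 \<and> (\<forall>n. s n \<in> pverts G) \<and>
     (\<forall>n\<ge>1. g (s n) = f (s (n - 1))) \<and> (\<forall>m n. (g (s n), g (s m)) \<in> sym_edges G)}"

definition points_of_coincidence :: "'x set \<Rightarrow> ('x \<Rightarrow> 'x) \<Rightarrow> ('x \<Rightarrow> 'x) \<Rightarrow> 'x set" where
  "points_of_coincidence X f g = {y \<in> X. \<exists>x\<in>X. y = f x \<and> y = g x}"

definition weakly_compatible :: "'x set \<Rightarrow> ('x \<Rightarrow> 'x) \<Rightarrow> ('x \<Rightarrow> 'x) \<Rightarrow> bool" where
  "weakly_compatible X f g \<longleftrightarrow> (\<forall>x\<in>X. f x = g x \<longrightarrow> f (g x) = g (f x))"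

end

theory Submission
  imports Defs
begin

text \<open>
  The norm is monotone on positive elements, so \<open>\<parallel>d x y\<parallel>\<close> is a real-valued \<open>b\<close>-metric with
  coefficient \<open>\<parallel>A\<parallel>\<close> and the contraction has the real constant \<open>\<parallel>B\<parallel>\<^sup>2\<close>; the fixed point argument
  then takes place in the reals.

  Monotonicity rests on the fact that a self-adjoint \<open>h\<close> has a spectral value of modulus \<open>\<parallel>h\<parallel>\<close>.
  It is obtained without holomorphic functions by Rickart's argument: for \<open>\<parallel>h\<parallel> = 1\<close>, if
  \<open>1 - w h\<close> were invertible for all \<open>|w| \<le> 1\<close>, then its inverse would be uniformly continuous
  in \<open>w\<close>. Averaging over roots of unity carries this, uniformly in \<open>m\<close>, to the inverses of
  \<open>1 - (w h)\<^sup>N\<close> with \<open>N = 2^m\<close>. For \<open>|w| < 1\<close> these tend to \<open>1\<close>, which forces \<open>\<parallel>h\<^sup>N\<parallel> < 1\<close> for some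
  \<open>m\<close>, whereas the C*-identity gives \<open>\<parallel>h\<^sup>N\<parallel> = 1\<close>.
\<close>

section \<open>Inverses in unital Banach algebras\<close>

definition inverses :: "'a::monoid_mult \<Rightarrow> 'a \<Rightarrow> bool" where
  "inverses a b \<longleftrightarrow> a * b = 1 \<and> b * a = 1"

text \<open>The Neumann series: multiplying it by \<open>x\<close> on either side drops its first
  term.\<close>

lemma inverses_one_minus_geometric:
  fixes x :: "'a::{real_normed_algebra_1,banach}"
  assumes "norm x < 1"
  shows "inverses (1 - x) (\<Sum>n. x ^ n)"
proof -
  have sm: "summable (\<lambda>n. x ^ n)"
    by (rule summable_comparison_test'[where g = "\<lambda>n. norm x ^ n" and N = 0])
      (use assms in \<open>auto simp: norm_power_ineq\<close>)
  have "(\<Sum>n. x ^ n) - 1 = (\<Sum>n. x ^ Suc n)"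
    using suminf_split_head[OF sm] by simp
  moreover have "(\<Sum>n. x ^ Suc n) = x * (\<Sum>n. x ^ n)"
    using suminf_mult[OF sm] by simp
  moreover have "(\<Sum>n. x ^ Suc n) = (\<Sum>n. x ^ n) * x"
    using suminf_mult2[OF sm] by (simp add: power_commutes)
  ultimately show ?thesis
    by (simp add: inverses_def algebra_simps)
qed

text \<open>Since b' - b = b' (a - a') b, the third assumption first gives norm b' <= 2 norm b.
  Substituting this leaves a bound free of \<open>b'\<close>, as continuity of inversion
  needs.\<close>

lemma norm_inverses_diff_le:
  fixes a a' :: "'a::real_normed_algebra_1"
  assumes "inverses a b" "inverses a' b'" "norm (a - a') * norm b \<le> 1 / 2"
  shows "norm (b' - b) \<le> 2 * (norm b)\<^sup>2 * norm (a - a')"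
proof -
  have eq: "b' - b = b' * ((a - a') * b)"
  proof -
    have "b' * ((a - a') * b) = b' * (a * b) - (b' * a') * b"
      by (simp add: algebra_simps)
    then show ?thesis
      using assms(1,2) by (simp add: inverses_def)
  qed
  have le: "norm (b' - b) \<le> norm b' * (norm (a - a') * norm b)"
    unfolding eq by (meson norm_mult_ineq mult_left_mono norm_ge_zero order_trans)
  also have "\<dots> \<le> norm b' * (1 / 2)"
    using assms(3) by (intro mult_left_mono) auto
  finally have "norm b' \<le> 2 * norm b"
    using norm_triangle_sub[of b' b] by simp
  then have "norm b' * (norm (a - a') * norm b) \<le> (2 * norm b) * (norm (a - a') * norm b)"
    by (intro mult_right_mono) auto
  with le show ?thesis
    by (simp add: power2_eq_square mult_ac)
qed

lemma continuous_on_inverses: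
  fixes F R :: "'b::metric_space \<Rightarrow> 'a::real_normed_algebra_1"
  assumes "continuous_on S F" and inv: "\<And>w. w \<in> S \<Longrightarrow> inverses (F w) (R w)"
  shows "continuous_on S R"
  unfolding continuous_on_def
proof
  fix w assume w: "w \<in> S"
  have F: "(F \<longlongrightarrow> F w) (at w within S)"
    using assms(1) w by (simp add: continuous_on_def)
  then have nF: "((\<lambda>z. norm (F w - F z)) \<longlongrightarrow> 0) (at w within S)"
    by (auto intro!: tendsto_eq_intros)
  have "((\<lambda>z. norm (F w - F z) * norm (R w)) \<longlongrightarrow> 0) (at w within S)"
    using tendsto_mult_right[OF nF] by simp
  then have "\<forall>\<^sub>F z in at w within S. norm (F w - F z) * norm (R w) < 1 / 2"
    by (rule order_tendstoD) simp
  moreover have "\<forall>\<^sub>F z in at w within S. z \<in> S"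
    by (simp add: eventually_at_filter)
  ultimately have "\<forall>\<^sub>F z in at w within S.
      norm (R z - R w) \<le> 2 * (norm (R w))\<^sup>2 * norm (F w - F z)"
    by eventually_elim (rule norm_inverses_diff_le, use inv w in auto)
  moreover have "((\<lambda>z. 2 * (norm (R w))\<^sup>2 * norm (F w - F z)) \<longlongrightarrow> 0) (at w within S)"
    using tendsto_mult_left[OF nF] by simp
  ultimately have "((\<lambda>z. R z - R w) \<longlongrightarrow> 0) (at w within S)"
    by (rule Lim_null_comparison)
  then show "(R \<longlongrightarrow> R w) (at w within S)"
    by (simp add: LIM_zero_iff)
qed

text \<open>Partial fractions: 1/(1 - y^2) is the mean of 1/(1 - y) and 1/(1 + y).\<close>

lemma inverses_one_minus_square:
  fixes y :: "'a::real_algebra_1"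
  assumes "inverses (1 - y) v" "inverses (1 + y) w"
  shows "inverses (1 - y\<^sup>2) ((1 / 2) *\<^sub>R (v + w))"
proof -
  have eq: "1 - y\<^sup>2 = (1 + y) * (1 - y)" "1 - y\<^sup>2 = (1 - y) * (1 + y)"
    by (simp_all add: algebra_simps power2_eq_square)
  have "(1 - y\<^sup>2) * v = 1 + y"
    using assms(1) by (simp only: inverses_def eq(1) mult.assoc mult_1_right)
  moreover have "(1 - y\<^sup>2) * w = 1 - y"
    using assms(2) by (simp only: inverses_def eq(2) mult.assoc mult_1_right)
  moreover have "v * (1 - y\<^sup>2) = 1 + y"
    using assms(1) by (simp only: inverses_def eq(2) mult_1_left flip: mult.assoc)
  moreover have "w * (1 - y\<^sup>2) = 1 - y"
    using assms(2) by (simp only: inverses_def eq(1) mult_1_left flip: mult.assoc)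
  ultimately show ?thesis
    by (simp add: inverses_def distrib_left distrib_right flip: scaleR_2)
qed

section \<open>Unital C*-algebras\<close>

lemma linear_scaleC_right: "linear (scaleC c :: 'a::unital_cstar_algebra \<Rightarrow> 'a)"
  by (rule linearI)
    (simp_all add: scaleC_add_right scaleC_scaleC mult.commute flip: scaleC_of_real)

lemma linear_scaleC_left: "linear (\<lambda>c. scaleC c (a :: 'a::unital_cstar_algebra))"
  by (rule linearI)
    (simp add: scaleC_add_left, metis scaleC_of_real scaleC_scaleC scaleR_conv_of_real)

lemma continuous_on_scaleC_left: "continuous_on S (\<lambda>c. scaleC c (a :: 'a::unital_cstar_algebra))"
  using linear_continuous_on linear_conv_bounded_linear linear_scaleC_left by blast

lemma scaleC_one [simp]: "scaleC 1 a = (a :: 'a::unital_cstar_algebra)"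
  using scaleC_of_real[of 1 a] by simp

lemma linear_adj: "linear (adj :: 'a::unital_cstar_algebra \<Rightarrow> 'a)"
  by (rule linearI) (simp_all add: adj_add adj_scaleC flip: scaleC_of_real)

lemma adj_one [simp]: "adj 1 = (1 :: 'a::unital_cstar_algebra)"
  by (metis adj_adj adj_mult mult_1_left mult_1_right)

lemma adj_power: "adj (a ^ n) = adj (a :: 'a::unital_cstar_algebra) ^ n"
  by (induction n) (simp_all add: adj_mult power_commutes)

lemma scaleC_power: "scaleC c a ^ n = scaleC (c ^ n) (a ^ n :: 'a::unital_cstar_algebra)"
  by (induction n) (simp_all add: mult_scaleC_left mult_scaleC_right scaleC_scaleC mult.commute)

text \<open>The C*-identity for \<open>adj a\<close>, followed by cancelling one factor
  \<open>norm (adj a)\<close>.\<close>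

lemma norm_adj_le: "norm (adj a) \<le> norm (a :: 'a::unital_cstar_algebra)"
proof (cases "adj a = 0")
  case False
  have "(norm (adj a))\<^sup>2 \<le> norm a * norm (adj a)"
    using cstar_identity[of "adj a"] norm_mult_ineq[of a "adj a"] by (simp add: adj_adj)
  then show ?thesis
    using False by (simp add: power2_eq_square)
qed simp

text \<open>\<open>h ^ 2 ^ m\<close> is self-adjoint, so by the C*-identity each squaring squares
  the norm.\<close>

lemma norm_self_adjoint_power:
  fixes h :: "'a::unital_cstar_algebra"
  assumes "adj h = h"
  shows "norm (h ^ 2 ^ m) = norm h ^ 2 ^ m"
proof (induction m)
  case (Suc m)
  have "norm (h ^ 2 ^ Suc m) = norm (adj (h ^ 2 ^ m) * h ^ 2 ^ m)"
    by (simp add: adj_power assms mult_2 power_add)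
  also have "\<dots> = norm h ^ 2 ^ Suc m"
    by (simp add: cstar_identity Suc mult.commute flip: power_mult)
  finally show ?case .
qed simp

lemma spectrum_iff: "z \<in> spectrum a \<longleftrightarrow> (\<nexists>b. inverses (scaleC z 1 - a) b)"
  by (simp add: spectrum_def inverses_def)

lemma inverses_scaleC:
  fixes a :: "'a::unital_cstar_algebra"
  assumes "inverses a b" "c \<noteq> 0"
  shows "inverses (scaleC c a) (scaleC (inverse c) b)"
  using assms by (simp add: inverses_def mult_scaleC_left mult_scaleC_right scaleC_scaleC)

lemma not_spectrum_iff:
  fixes a :: "'a::unital_cstar_algebra"
  assumes "z \<noteq> 0"
  shows "z \<notin> spectrum a \<longleftrightarrow> (\<exists>b. inverses (1 - scaleC (inverse z) a) b)"
proof -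
  have 1: "scaleC z 1 - a = scaleC z (1 - scaleC (inverse z) a)"
    using assms by (simp add: linear_diff[OF linear_scaleC_right] scaleC_scaleC)
  have 2: "1 - scaleC (inverse z) a = scaleC (inverse z) (scaleC z 1 - a)"
    using assms by (simp add: linear_diff[OF linear_scaleC_right] scaleC_scaleC)
  show ?thesis
    unfolding spectrum_iff using inverses_scaleC[of _ _ z] inverses_scaleC[of _ _ "inverse z"]
    by (metis 1 2 assms inverse_nonzero_iff_nonzero)
qed

lemma spectrum_norm_le:
  fixes a :: "'a::unital_cstar_algebra"
  assumes "z \<in> spectrum a"
  shows "cmod z \<le> norm a"
proof (rule ccontr)
  assume *: "\<not> cmod z \<le> norm a"
  then have "z \<noteq> 0"
    using norm_ge_zero[of a] by auto
  moreover from * this have "norm (scaleC (inverse z) a) < 1"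
    by (simp add: norm_scaleC norm_inverse norm_divide field_simps)
  ultimately show False
    using assms not_spectrum_iff inverses_one_minus_geometric by blast
qed

lemma spectrum_add_scalar:
  fixes a :: "'a::unital_cstar_algebra"
  shows "z \<in> spectrum (scaleR t 1 + a) \<longleftrightarrow> z - of_real t \<in> spectrum a"
proof -
  have "scaleC z 1 - (scaleR t 1 + a) = scaleC (z - of_real t) 1 - a"
    by (simp add: linear_diff[OF linear_scaleC_left] scaleC_of_real)
  then show ?thesis
    unfolding spectrum_iff by metis
qed

lemma spectrum_minus:
  fixes a :: "'a::unital_cstar_algebra"
  shows "z \<in> spectrum (- a) \<longleftrightarrow> - z \<in> spectrum a"
proof -
  have "inverses (- x) (- b) \<longleftrightarrow> inverses x b" for x b :: 'a
    by (simp add: inverses_def)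
  then have "(\<exists>b. inverses (- x) b) \<longleftrightarrow> (\<exists>b. inverses x b)" for x :: 'a
    by (metis minus_minus)
  moreover have "scaleC z 1 - - a = - (scaleC (- z) 1 - a)"
    by (simp add: linear_neg[OF linear_scaleC_left])
  ultimately show ?thesis
    unfolding spectrum_iff by metis
qed

section \<open>The norm of a self-adjoint element as a spectral radius\<close>

text \<open>
  Passing from \<open>m\<close> to \<open>m + 1\<close> averages the inverses of \<open>1 - y\<close> and \<open>1 + y\<close>, and \<open>- y\<close> arises
  from \<open>y = (u h)^(2^m)\<close> by rotating \<open>u\<close>, so the bound \<open>e\<close> does not deteriorate.
\<close>
lemma inverses_one_minus_power_close:
  fixes h :: "'a::unital_cstar_algebra" and t :: real
  assumes close: "\<And>u. cmod u = 1 \<Longrightarrow> \<exists>v w. inverses (1 - scaleC u h) v \<and>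
      inverses (1 - scaleC (of_real t * u) h) w \<and> norm (v - w) \<le> e"
    and "cmod u = 1"
  shows "\<exists>v w. inverses (1 - scaleC u h ^ 2 ^ m) v \<and>
      inverses (1 - scaleC (of_real t * u) h ^ 2 ^ m) w \<and> norm (v - w) \<le> e"
  using assms(2)
proof (induction m arbitrary: u)
  case 0
  then show ?case
    using close by simp
next
  case (Suc m)
  \<comment> \<open>A 2^m-th root of -1: rotating by \<open>w\<close> flips the sign of the power at
    radius 1 and at radius \<open>t\<close> alike.\<close>
  define w where "w = cis (pi / 2 ^ m)"
  have w: "w ^ 2 ^ m = - 1"
  proof -
    have "real (2 ^ m) * (pi / 2 ^ m) = pi"
      by simp
    then show ?thesis
      by (simp only: w_def Complex.DeMoivre cis_pi)
  qed
  have neg: "scaleC (z * w) h ^ 2 ^ m = - (scaleC z h ^ 2 ^ m)" for z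
    by (simp add: scaleC_power power_mult_distrib w linear_neg[OF linear_scaleC_left])
  have "cmod (u * w) = 1"
    using Suc.prems by (simp add: norm_mult w_def)
  from Suc.IH[OF this] Suc.IH[OF Suc.prems] obtain v1 w1 v2 w2 where
    1: "inverses (1 - scaleC u h ^ 2 ^ m) v1" "inverses (1 + scaleC u h ^ 2 ^ m) v2" and
    2: "inverses (1 - scaleC (of_real t * u) h ^ 2 ^ m) w1"
       "inverses (1 + scaleC (of_real t * u) h ^ 2 ^ m) w2" and
    n: "norm (v1 - w1) \<le> e" "norm (v2 - w2) \<le> e"
    by (auto simp: neg simp flip: mult.assoc)
  have "norm ((1 / 2) *\<^sub>R (v1 + v2) - (1 / 2) *\<^sub>R (w1 + w2)) =
      norm ((1 / 2) *\<^sub>R ((v1 - w1) + (v2 - w2)))"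
    by (simp add: algebra_simps)
  also have "\<dots> \<le> e"
    using norm_triangle_mono[OF n] by simp
  finally show ?case
    using inverses_one_minus_square[OF 1] inverses_one_minus_square[OF 2]
    by (auto simp: mult.commute[of 2] power_mult)
qed

lemma norm_power_less_one:
  fixes h :: "'a::unital_cstar_algebra"
  assumes "norm h \<le> 1" and inv: "\<And>w. cmod w \<le> 1 \<Longrightarrow> \<exists>b. inverses (1 - scaleC w h) b"
  shows "\<exists>m. norm (h ^ 2 ^ m) < 1"
proof -
  define R where "R w = (SOME b. inverses (1 - scaleC w h) b)" for w
  have R: "inverses (1 - scaleC w h) (R w)" if "cmod w \<le> 1" for w
    unfolding R_def by (rule someI_ex) (rule inv[OF that])
  have "continuous_on (cball 0 1) R"
    by (rule continuous_on_inverses[where F = "\<lambda>w. 1 - scaleC w h"])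
      (auto intro!: continuous_intros continuous_on_scaleC_left R)
  then have "uniformly_continuous_on (cball 0 1) R"
    by (simp add: compact_uniformly_continuous)
  \<comment> \<open>The value 1/12 suits the end: with norm (w - 1) <= 1/3 it gives norm (v - 1) <=
    5/12 < 1/2, which forces norm y < 1.\<close>
  from uniformly_continuous_onE[OF this, of "1 / 12"]
  obtain \<delta> where "\<delta> > 0" and \<delta>: "\<And>z w. cmod z \<le> 1 \<Longrightarrow> cmod w \<le> 1 \<Longrightarrow> dist w z < \<delta> \<Longrightarrow>
      dist (R w) (R z) < 1 / 12"
    by auto
  define t where "t = max 0 (1 - \<delta> / 2)"
  have t: "0 \<le> t" "t < 1" "1 - t < \<delta>"
    using \<open>\<delta> > 0\<close> by (auto simp: t_def)
  have "\<exists>v w. inverses (1 - scaleC u h) v \<and>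
      inverses (1 - scaleC (of_real t * u) h) w \<and> norm (v - w) \<le> 1 / 12" if u: "cmod u = 1" for u
  proof (intro exI conjI)
    have "cmod (u - of_real t * u) = cmod (of_real (1 - t) * u)"
      by (simp add: algebra_simps)
    also have "\<dots> = 1 - t"
      using t u by (simp only: norm_mult norm_of_real) simp
    finally have "dist u (of_real t * u) < \<delta>"
      using t by (simp add: dist_norm)
    with \<delta>[of "of_real t * u" u] show "norm (R u - R (of_real t * u)) \<le> 1 / 12"
      using t u by (simp add: norm_mult dist_norm)
  qed (use R t u in \<open>auto simp: norm_mult\<close>)
  note close = inverses_one_minus_power_close[OF this, where u = 1]
  \<comment> \<open>\<open>n\<close> also serves as the number of squarings, since t^(2^n) <= t^n
    for 0 <= t < 1.\<close>
  obtain n where n: "t ^ n < 1 / 4"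
    using t(2) real_arch_pow_inv[of "1/4" t] by auto
  define y where "y = h ^ 2 ^ n"
  define y' where "y' = scaleC (of_real t) h ^ 2 ^ n"
  obtain v w where v: "inverses (1 - y) v" and w: "inverses (1 - y') w"
    and vw: "norm (v - w) \<le> 1 / 12"
    using close[of n] by (auto simp: y_def y'_def)
  have "norm y' = norm (t ^ 2 ^ n *\<^sub>R h ^ 2 ^ n)"
    by (simp add: y'_def scaleC_power flip: scaleC_of_real)
  also have "\<dots> \<le> t ^ 2 ^ n * 1"
    using t assms(1) unfolding norm_scaleR
    by (intro mult_mono) (auto intro: order_trans[OF norm_power_ineq power_le_one])
  also have "\<dots> \<le> t ^ n"
    using t by (auto intro: power_decreasing less_imp_le)
  finally have y': "norm y' \<le> 1 / 4"
    using n by simp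
  have "w - 1 = y' * w"
    using w by (simp add: inverses_def algebra_simps)
  then have "norm (w - 1) \<le> norm y' * norm w"
    by (simp add: norm_mult_ineq)
  also have "\<dots> \<le> 1 / 4 * (1 + norm (w - 1))"
    using y' norm_triangle_sub[of w 1] by (intro mult_mono) auto
  finally have "norm (w - 1) \<le> 1 / 3"
    by simp
  then have q: "norm (v - 1) \<le> 5 / 12"
    using vw norm_triangle_ineq[of "v - w" "w - 1"] by simp
  have "y = (v - 1) - y * (v - 1)"
    using v by (simp add: inverses_def algebra_simps)
  then have "norm y \<le> norm (v - 1) + norm y * norm (v - 1)"
    by (metis norm_triangle_ineq4 norm_mult_ineq add_left_mono order_trans)
  also have "\<dots> \<le> 5 / 12 + norm y * (5 / 12)"
    using q by (intro add_mono mult_left_mono) auto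
  finally have "norm y < 1"
    by simp
  then show ?thesis
    unfolding y_def by blast
qed

lemma self_adjoint_spectrum_norm:
  fixes h :: "'a::unital_cstar_algebra"
  assumes "adj h = h"
  obtains z where "z \<in> spectrum h" "cmod z = norm h"
proof -
  have "\<exists>z\<in>spectrum h. cmod z = norm h"
  proof (cases "h = 0")
    case True
    then have "0 \<in> spectrum h"
      by (simp add: spectrum_iff inverses_def linear_0[OF linear_scaleC_left])
    with True show ?thesis
      by force
  next
    case False
    \<comment> \<open>A real factor normalises \<open>h\<close> to norm 1 and keeps it
      self-adjoint.\<close>
    define c :: complex where "c = of_real (inverse (norm h))"
    have c: "cmod c * norm h = 1" "c \<noteq> 0"
      using False by (simp_all add: c_def norm_inverse)
    show ?thesis
    proof (rule ccontr)
      assume no: "\<not> ?thesis"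
      have "\<exists>b. inverses (1 - scaleC w (scaleC c h)) b" if w: "cmod w \<le> 1" for w
      proof (cases "w = 0")
        case True
        then show ?thesis
          by (auto simp: inverses_def linear_0[OF linear_scaleC_left])
      next
        case wn: False
        \<comment> \<open>The candidate spectral value \<open>inverse (w * c)\<close> has modulus at
          least \<open>norm h\<close>. No spectral value exceeds \<open>norm h\<close> in modulus,
          and equality is excluded by \<open>no\<close>.\<close>
        have "cmod (inverse (w * c)) = norm h / cmod w"
          using inverse_unique[OF c(1)] by (simp add: norm_mult norm_inverse divide_inverse)
        moreover have "norm h \<le> norm h / cmod w"
          using w wn by (simp add: le_divide_eq mult_left_le)
        ultimately have "norm h \<le> cmod (inverse (w * c))"
          by simp
        then have "inverse (w * c) \<notin> spectrum h"
          using no spectrum_norm_le by (metis order_antisym)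
        then show ?thesis
          using c wn not_spectrum_iff[of "inverse (w * c)" h] by (simp add: scaleC_scaleC)
      qed
      then obtain m where "norm (scaleC c h ^ 2 ^ m) < 1"
        using norm_power_less_one[of "scaleC c h"] c by (auto simp: norm_scaleC)
      moreover have "adj (scaleC c h) = scaleC c h"
        by (simp add: c_def adj_scaleC assms)
      then have "norm (scaleC c h ^ 2 ^ m) = 1"
        using c by (simp add: norm_self_adjoint_power norm_scaleC)
      ultimately show False
        by simp
    qed
  qed
  then show ?thesis
    using that by blast
qed

section \<open>Positive elements\<close>

lemma positive_spectrumE:
  assumes "positive a" "z \<in> spectrum a"
  obtains r where "z = of_real r" "0 \<le> r"
proof -
  have "z \<in> \<real>\<^sub>\<ge>\<^sub>0"
    using assms by (auto simp: positive_def)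
  then show ?thesis
    using that by (rule nonneg_Reals_cases)
qed

lemma norm_in_spectrum_positive:
  assumes "positive a"
  shows "of_real (norm a) \<in> spectrum a"
proof -
  have "adj a = a"
    using assms by (simp add: positive_def)
  then obtain z where z: "z \<in> spectrum a" "cmod z = norm a"
    by (rule self_adjoint_spectrum_norm)
  obtain r where "z = of_real r" "0 \<le> r"
    using positive_spectrumE[OF assms z(1)] .
  with z show ?thesis
    by simp
qed

text \<open>The spectrum of \<open>a\<close> lies in [0, norm a], so the reflection r -> norm a - r
  keeps it there; self-adjointness realises the norm as the modulus of a spectral value.\<close>

lemma norm_scalar_minus_positive_le:
  fixes a :: "'a::unital_cstar_algebra"
  assumes "positive a"
  shows "norm (norm a *\<^sub>R 1 - a) \<le> norm a"
proof -
  have "adj (norm a *\<^sub>R 1 - a) = norm a *\<^sub>R 1 - a"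
    using assms by (simp add: positive_def linear_diff[OF linear_adj] linear_scale[OF linear_adj])
  then obtain z where z: "z \<in> spectrum (norm a *\<^sub>R 1 - a)" "cmod z = norm (norm a *\<^sub>R 1 - a)"
    by (rule self_adjoint_spectrum_norm)
  then have sp: "of_real (norm a) - z \<in> spectrum a"
    using spectrum_add_scalar[of z "norm a" "- a"] by (simp add: spectrum_minus)
  obtain r where r: "of_real (norm a) - z = of_real r" "0 \<le> r"
    using positive_spectrumE[OF assms sp] .
  have "r \<le> norm a"
    using spectrum_norm_le[OF sp] r by simp
  moreover have "z = of_real (norm a - r)"
    using r(1) by (simp add: algebra_simps)
  then have "cmod z = \<bar>norm a - r\<bar>"
    by (simp only: norm_of_real)
  ultimately show ?thesis
    using z(2) r(2) by linarith
qed

text \<open>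
  With \<open>c = b - a\<close> and \<open>t = \<parallel>c\<parallel>\<close>, the number \<open>t + \<parallel>a\<parallel>\<close> lies in the spectrum of
  \<open>t + a = b + (t - c)\<close>, and \<open>\<parallel>t - c\<parallel> \<le> t\<close>. This avoids proving that sums of positive elements
  are positive.
\<close>
lemma norm_mono_positive:
  fixes a b :: "'a::unital_cstar_algebra"
  assumes "0 \<preceq> a" "a \<preceq> b"
  shows "norm a \<le> norm b"
proof -
  define t where "t = norm (b - a)"
  have a: "positive a" and c: "positive (b - a)"
    using assms by (simp_all add: cstar_le_def)
  have "of_real (t + norm a) \<in> spectrum (t *\<^sub>R 1 + a)"
    using norm_in_spectrum_positive[OF a] by (simp add: spectrum_add_scalar)
  from spectrum_norm_le[OF this] have "t + norm a \<le> norm (t *\<^sub>R 1 + a)"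
    by (simp only: norm_of_real abs_of_nonneg t_def add_nonneg_nonneg norm_ge_zero)
  also have "\<dots> = norm (b + (t *\<^sub>R 1 - (b - a)))"
    by (simp add: algebra_simps)
  also have "\<dots> \<le> norm b + t"
    using norm_scalar_minus_positive_le[OF c] unfolding t_def
    by (intro norm_triangle_le add_left_mono)
  finally show ?thesis
    by simp
qed

text \<open>Only 1 can be a spectral value. The result serves to turn \<open>1 \<preceq> A\<close>
  into \<open>1 \<le> norm A\<close>, the coefficient condition of the real b-metric.\<close>

lemma zero_cstar_le_one: "0 \<preceq> (1 :: 'a::unital_cstar_algebra)"
proof -
  have "z = 1" if "z \<in> spectrum (1 :: 'a)" for z
  proof (rule ccontr)
    assume "z \<noteq> 1"
    then have "inverses (scaleC (z - 1) 1) (scaleC (inverse (z - 1)) (1 :: 'a))"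
      by (intro inverses_scaleC) (auto simp: inverses_def)
    then show False
      using that by (simp add: spectrum_iff linear_diff[OF linear_scaleC_left])
  qed
  then have "spectrum (1 :: 'a) \<subseteq> {1}"
    by blast
  then have "spectrum (1 :: 'a) \<subseteq> \<real>\<^sub>\<ge>\<^sub>0"
    by (rule order_trans) simp
  then show ?thesis
    by (simp add: cstar_le_def positive_def)
qed

section \<open>Coincidence points in real-valued b-metric spaces\<close>

locale real_b_metric =
  fixes X :: "'x set" and \<rho> :: "'x \<Rightarrow> 'x \<Rightarrow> real" and s :: real
  assumes nonneg: "\<And>x y. 0 \<le> \<rho> x y"
    and coeff: "1 \<le> s"
    and eq_0_iff: "\<And>x y. x \<in> X \<Longrightarrow> y \<in> X \<Longrightarrow> \<rho> x y = 0 \<longleftrightarrow> x = y"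
    and sym: "\<And>x y. x \<in> X \<Longrightarrow> y \<in> X \<Longrightarrow> \<rho> x y = \<rho> y x"
    and triangle: "\<And>x y z. x \<in> X \<Longrightarrow> y \<in> X \<Longrightarrow> z \<in> X \<Longrightarrow> \<rho> x y \<le> s * (\<rho> x z + \<rho> z y)"
begin

text \<open>The contraction holds for all index pairs, so the distances from \<open>z 0\<close> are
  bounded first, and shifting both indices n times shrinks the bound by k^n. This avoids chains of
  triangle inequalities, which would accumulate powers of \<open>s\<close>.\<close>

lemma contracting_orbit_Cauchy:
  assumes z: "\<And>n. z n \<in> X"
    and contr: "\<And>m n. \<rho> (z (Suc m)) (z (Suc n)) \<le> k * \<rho> (z m) (z n)"
    and k: "0 \<le> k" "s * k < 1" and "e > 0"
  shows "\<exists>N. \<forall>m\<ge>N. \<forall>n\<ge>N. \<rho> (z m) (z n) \<le> e"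
proof -
  have k1: "k < 1"
    using k coeff mult_right_mono[OF coeff k(1)] by simp
  \<comment> \<open>The solution of M = s (rho(z 0, z 1) + k M), so that the bound reproduces itself
    in the induction on \<open>p\<close>.\<close>
  define M where "M = s * \<rho> (z 0) (z 1) / (1 - s * k)"
  have M: "s * \<rho> (z 0) (z 1) + s * k * M = M"
    using k(2) by (simp add: M_def field_simps)
  have M0: "0 \<le> M"
    using k coeff nonneg[of "z 0" "z 1"] by (simp add: M_def)
  have bd: "\<rho> (z 0) (z p) \<le> M" for p
  proof (induction p)
    case 0
    then show ?case
      using M0 eq_0_iff[OF z z, of 0 0] by simp
  next
    case (Suc p)
    have "\<rho> (z 0) (z (Suc p)) \<le> s * (\<rho> (z 0) (z 1) + \<rho> (z 1) (z (Suc p)))"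
      by (rule triangle) (auto simp: z)
    also have "\<dots> \<le> s * (\<rho> (z 0) (z 1) + k * M)"
      using coeff contr[of 0 p] mult_left_mono[OF Suc k(1)]
      by (intro mult_left_mono add_mono) auto
    also have "\<dots> = M"
      using M by (simp add: algebra_simps)
    finally show ?case .
  qed
  have it: "\<rho> (z n) (z (n + p)) \<le> k ^ n * M" for n p
  proof (induction n)
    case 0
    then show ?case
      using bd by simp
  next
    case (Suc n)
    then show ?case
      using contr[of n "n + p"] mult_left_mono[OF Suc k(1)] by (simp add: mult.assoc)
  qed
  have "(\<lambda>n. k ^ n * M) \<longlonglongrightarrow> 0"
    using k k1 by (auto intro!: tendsto_eq_intros LIMSEQ_realpow_zero)
  from order_tendstoD(2)[OF this \<open>e > 0\<close>] obtain N where N: "\<And>n. n \<ge> N \<Longrightarrow> k ^ n * M < e"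
    by (auto simp: eventually_sequentially)
  have "\<rho> (z m) (z n) \<le> e" if "N \<le> m" "m \<le> n" for m n
    using it[of m "n - m"] N[of m] that by simp
  then have "\<rho> (z m) (z n) \<le> e" if "N \<le> m" "N \<le> n" for m n
    using that sym z by (metis nle_le)
  then show ?thesis
    by blast
qed

text \<open>The triangle inequality through \<open>y (Suc (r i))\<close>, which is close to
  \<open>q\<close> by contraction and to \<open>p\<close> by convergence. In use y n = g (z n), p =
  g u and q = f u; the index shift is g (z (n + 1)) = f (z n).\<close>

lemma limit_is_coincidence:
  fixes r :: "nat \<Rightarrow> nat"
  assumes X: "p \<in> X" "q \<in> X" "\<And>n. y n \<in> X"
    and lim: "(\<lambda>n. \<rho> (y n) p) \<longlonglongrightarrow> 0"
    and r: "strict_mono r"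
    and contr: "\<And>i. i \<ge> 1 \<Longrightarrow> \<rho> (y (Suc (r i))) q \<le> k * \<rho> (y (r i)) p"
  shows "q = p"
proof -
  have 1: "(\<lambda>i. \<rho> (y (r i)) p) \<longlonglongrightarrow> 0"
    using LIMSEQ_subseq_LIMSEQ[OF lim r] by (simp add: o_def)
  have 2: "(\<lambda>i. \<rho> (y (Suc (r i))) p) \<longlonglongrightarrow> 0"
    using LIMSEQ_subseq_LIMSEQ[OF LIMSEQ_Suc[OF lim] r] by (simp add: o_def)
  have "(\<lambda>i. s * (k * \<rho> (y (r i)) p + \<rho> (y (Suc (r i))) p)) \<longlonglongrightarrow> s * (k * 0 + 0)"
    by (intro tendsto_intros 1 2)
  moreover have "\<rho> q p \<le> s * (k * \<rho> (y (r i)) p + \<rho> (y (Suc (r i))) p)" if "i \<ge> 1" for i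
  proof -
    have "\<rho> q p \<le> s * (\<rho> q (y (Suc (r i))) + \<rho> (y (Suc (r i))) p)"
      using X by (intro triangle)
    also have "\<dots> \<le> s * (k * \<rho> (y (r i)) p + \<rho> (y (Suc (r i))) p)"
      using contr[OF that] sym[OF X(2) X(3)] coeff by (intro mult_left_mono) auto
    finally show ?thesis .
  qed
  ultimately have "\<rho> q p \<le> 0"
    by (intro LIMSEQ_le_const[where X = "\<lambda>i. s * (k * \<rho> (y (r i)) p + \<rho> (y (Suc (r i))) p)"]) auto
  then show ?thesis
    using nonneg[of q p] X eq_0_iff by simp
qed

end

section \<open>Transfer from the C*-algebra-valued metric to the real one\<close>

lemma (in cstar_b_metric_space) real_b_metric_norm:
  "real_b_metric X (\<lambda>x y. norm (d x y)) (norm A)"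
proof
  show "1 \<le> norm A"
    using norm_mono_positive[OF zero_cstar_le_one coeff_ge_one] by simp
next
  fix x y z assume "x \<in> X" "y \<in> X" "z \<in> X"
  then have "norm (d x y) \<le> norm (A * (d x z + d z y))"
    by (intro norm_mono_positive dist_nonneg dist_triangle)
  also have "\<dots> \<le> norm A * (norm (d x z) + norm (d z y))"
    by (meson norm_mult_ineq norm_triangle_ineq mult_left_mono norm_ge_zero order_trans)
  finally show "norm (d x y) \<le> norm A * (norm (d x z) + norm (d z y))" .
qed (use dist_eq_0_iff dist_sym in auto)

lemma norm_conjugate_le:
  fixes B c :: "'a::unital_cstar_algebra"
  shows "norm (adj B * c * B) \<le> (norm B)\<^sup>2 * norm c"
proof -
  have "norm (adj B * c * B) \<le> norm (adj B) * norm c * norm B"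
    by (meson norm_mult_ineq mult_right_mono norm_ge_zero order_trans)
  also have "\<dots> \<le> norm B * norm c * norm B"
    by (intro mult_right_mono norm_adj_le) auto
  finally show ?thesis
    by (simp add: power2_eq_square mult_ac)
qed

theorem theorem3p1:
  fixes X :: "'x set"
    and d :: "'x \<Rightarrow> 'x \<Rightarrow> 'a::unital_cstar_algebra"
    and A B :: 'a
    and G :: "'x pair_pre_digraph"
    and f g :: "'x \<Rightarrow> 'x"
  assumes "cstar_b_metric_space X d A"
    and "pair_wf_digraph G" and "pverts G = X" and "Id_on X \<subseteq> parcs G"
    and "f \<in> X \<rightarrow> X" and "g \<in> X \<rightarrow> X"
    and "norm A * (norm B)\<^sup>2 < 1"
    and "\<And>x y. \<lbrakk>x \<in> X; y \<in> X; (g x, g y) \<in> sym_edges G\<rbrakk> \<Longrightarrow>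
           d (f x) (f y) \<preceq> adj B * d (g x) (g y) * B"
    and "f ` X \<subseteq> g ` X"
    and "cstar_complete d (g ` X)"
    and "\<And>s x. \<lbrakk>\<And>n. s n \<in> X; x \<in> X; cstar_converges d (\<lambda>n. g (s n)) x;
            \<And>n. n \<ge> 1 \<Longrightarrow> (g (s n), g (s (n + 1))) \<in> sym_edges G\<rbrakk> \<Longrightarrow>
           \<exists>r :: nat \<Rightarrow> nat. strict_mono r \<and> (\<forall>i\<ge>1. (g (s (r i)), x) \<in> sym_edges G)"
    and "C_gf G g f \<noteq> {}"
  shows "points_of_coincidence X f g \<noteq> {} \<and>
    ((\<forall>x \<in> points_of_coincidence X f g. \<forall>y \<in> points_of_coincidence X f g.
        (x, y) \<in> sym_edges G) \<longrightarrow>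
      is_singleton (points_of_coincidence X f g) \<and>
      (weakly_compatible X f g \<longrightarrow> (\<exists>!x. x \<in> X \<and> x = f x \<and> x = g x)))"
proof -
  interpret cstar_b_metric_space X d A by fact
  interpret real_b_metric X "\<lambda>x y. norm (d x y)" "norm A"
    by (rule real_b_metric_norm)
  let ?k = "(norm B)\<^sup>2"
  let ?PC = "points_of_coincidence X f g"
  have fX: "f x \<in> X" and gX: "g x \<in> X" if "x \<in> X" for x
    using assms(5,6) that by auto
  have k1: "?k < 1"
    using assms(7) mult_right_mono[OF coeff, of ?k] by simp
  have contr: "norm (d (f x) (f y)) \<le> ?k * norm (d (g x) (g y))"
    if "x \<in> X" "y \<in> X" "(g x, g y) \<in> sym_edges G" for x y
  proof -
    have "norm (d (f x) (f y)) \<le> norm (adj B * d (g x) (g y) * B)"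
      by (intro norm_mono_positive dist_nonneg assms(8) fX that)
    also have "\<dots> \<le> ?k * norm (d (g x) (g y))"
      by (rule norm_conjugate_le)
    finally show ?thesis .
  qed

  obtain z where z: "\<And>n. z n \<in> X" and step: "\<And>n. g (z (Suc n)) = f (z n)"
    and edge: "\<And>m n. (g (z n), g (z m)) \<in> sym_edges G"
  proof -
    from assms(12) obtain x0 where "x0 \<in> C_gf G g f"
      by blast
    then obtain z :: "nat \<Rightarrow> 'x" where "\<forall>n. z n \<in> X" "\<forall>n\<ge>1. g (z n) = f (z (n - 1))"
      and "\<forall>m n. (g (z n), g (z m)) \<in> sym_edges G"
      unfolding C_gf_def mem_Collect_eq assms(3) by (elim conjE exE)
    then show ?thesis
      by (intro that[of z]) (simp_all only: le_add1 plus_1_eq_Suc[symmetric] diff_add_inverse)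
  qed
  have "\<exists>N. \<forall>m\<ge>N. \<forall>n\<ge>N. norm (d (g (z m)) (g (z n))) \<le> e" if "e > 0" for e
  proof (rule contracting_orbit_Cauchy)
    \<comment> \<open>\<open>C_gf\<close> provides edges between all pairs of orbit points, hence
      the contraction for all \<open>m\<close> and \<open>n\<close>, not only for
      neighbours.\<close>
    show "norm (d (g (z (Suc m))) (g (z (Suc n)))) \<le> ?k * norm (d (g (z m)) (g (z n)))" for m n
      unfolding step by (intro contr z edge)
  qed (use that z gX assms(7) in simp_all)
  then have "cstar_Cauchy d (\<lambda>n. g (z n))"
    by (simp add: cstar_Cauchy_def)
  moreover have "\<forall>n. g (z n) \<in> g ` X"
    using z by simp
  ultimately have "\<exists>y\<in>g ` X. cstar_converges d (\<lambda>n. g (z n)) y"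
    using assms(10)[unfolded cstar_complete_def, rule_format, of "\<lambda>n. g (z n)"] by simp
  \<comment> \<open>The limit lies in the image of \<open>g\<close>; its preimage \<open>u\<close>
    is the candidate coincidence point.\<close>
  then obtain u where u: "u \<in> X" and lim: "cstar_converges d (\<lambda>n. g (z n)) (g u)"
    by blast
  obtain r :: "nat \<Rightarrow> nat" where r: "strict_mono r" "\<And>i. i \<ge> 1 \<Longrightarrow> (g (z (r i)), g u) \<in> sym_edges G"
    using assms(11)[OF z gX[OF u] lim edge] by blast
  have "f u = g u"
  proof (rule limit_is_coincidence)
    show "(\<lambda>n. norm (d (g (z n)) (g u))) \<longlonglongrightarrow> 0"
      using lim by (simp add: cstar_converges_def)
    show "norm (d (g (z (Suc (r i)))) (f u)) \<le> ?k * norm (d (g (z (r i))) (g u))" if "i \<ge> 1" for i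
      using contr[OF z u r(2)[OF that]] by (simp add: step)
  qed (use u z fX gX r(1) in simp_all)
  have PC_I: "g x \<in> ?PC" if "x \<in> X" "f x = g x" for x
    unfolding points_of_coincidence_def using that gX[of x] by force
  have PC: "g u \<in> ?PC"
    using u \<open>f u = g u\<close> by (rule PC_I)

  have "is_singleton ?PC \<and>
      (weakly_compatible X f g \<longrightarrow> (\<exists>!x. x \<in> X \<and> x = f x \<and> x = g x))"
    if E: "\<forall>x\<in>?PC. \<forall>y\<in>?PC. (x, y) \<in> sym_edges G"
  proof -
    have unique: "x = y" if xy: "x \<in> ?PC" "y \<in> ?PC" for x y
    proof -
      obtain a b where ab: "a \<in> X" "x = f a" "x = g a" "b \<in> X" "y = f b" "y = g b"
        using xy by (auto simp: points_of_coincidence_def)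
      \<comment> \<open>Both maps send \<open>a\<close> to \<open>x\<close> and \<open>b\<close> to
        \<open>y\<close>, so the contraction compares \<open>d x y\<close> with itself.\<close>
      then have "norm (d x y) \<le> ?k * norm (d x y)"
        using contr[of a b] E xy by metis
      then have "(1 - ?k) * norm (d x y) \<le> 0"
        by (simp add: algebra_simps)
      then have "norm (d x y) \<le> 0"
        using k1 by (simp add: mult_le_0_iff)
      then show ?thesis
        using ab fX dist_eq_0_iff[of x y] by simp
    qed
    have "\<exists>!x. x \<in> X \<and> x = f x \<and> x = g x" if wc: "weakly_compatible X f g"
    proof -
      \<comment> \<open>Weak compatibility makes \<open>g u\<close> a coincidence point as well; its
        value \<open>g (g u)\<close> must then be the only point of coincidence,
        \<open>g u\<close>.\<close>
      have gg: "f (g u) = g (g u)"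
        using wc u \<open>f u = g u\<close> by (metis weakly_compatible_def)
      have "g (g u) = g u"
        using unique[OF PC_I[OF gX[OF u] gg] PC] .
      with gg have "g u \<in> X \<and> g u = f (g u) \<and> g u = g (g u)"
        using gX[OF u] by simp
      \<comment> \<open>A common fixed point is a point of coincidence with itself as
        witness.\<close>
      moreover have "x = g u" if "x \<in> X \<and> x = f x \<and> x = g x" for x
        using unique[OF PC_I PC, of x] that by simp
      ultimately show ?thesis
        by blast
    qed
    moreover have "is_singleton ?PC"
      using PC unique by (auto intro: is_singletonI')
    ultimately show ?thesis
      by blast
  qed
  with PC show ?thesis
    by blast
qed

end
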